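(* For all $n\ge 2$ the following partial difference equations hold: $$\Delta_m^2 f_{2n}(m,k)+4\,f_{2n-2}(m,k-2)=0\qquad (2\le m\le k-3<k\le 2n-1),$$ $$\Delta_k^2 f_{2n}(m,k)+4\,f_{2n-2}(m,k)=0\qquad (2\le m\le k-1<k\le 2n-3).$$
   Context: An increasing tree of size $N$ is a planar binary tree with $N$ nodes labeled bijectively by $1,\dots,N$, the root labeled $1$, each node having $0$, $1$ or $2$ children, each child designated as a left child or a right child (at most one of each), and each node's label smaller than its children's labels. Its rightmost node is the node reached from the root by repeatedly moving to the right child until a node without right child is reached. The tree is complete if every node is either a leaf or has two children, except that when $N$ is even the rightmost node has exactly one child, which is a left child. Let $\mathfrak T_N$ be the set of complete increasing trees of size $N$; trees in $\mathfrak T_{2n}$ are called secant trees. For $t\in\mathfrak T_N$: for a node $a$ with children, let $\min a$ be the smallest label of its children; the minimal chain is $a_1=1, a_2=\min a_1,\dots$, continued until a leaf $a_j$ is reached, and $\mathrm{eoc}(t):=a_j$. The node labeled $N$ is a leaf; $\mathrm{pom}(t)$ is the label of its parent. Set $f_{2n}(m,k):=\#\{t\in\mathfrak T_{2n}:\mathrm{eoc}(t)=m,\ \mathrm{pom}(t)=k\}$, with the convention $f_{2n}(m,k)=0$ if $(m,k)\notin[2,2n]\times[1,2n-1]$. Partial differences: $\Delta_m f_{2n}(m,k)=f_{2n}(m+1,k)-f_{2n}(m,k)$, $\Delta_k f_{2n}(m,k)=f_{2n}(m,k+1)-f_{2n}(m,k)$, and $\Delta^2$ denotes the iterated difference. 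*)

theory Defs
  imports Main "HOL-Library.Tree"
begin

(* Planar binary trees are values of the library type 'a tree. The constructor Leaf is the empty
   tree, i.e. an absent child, and not a leaf in the combinatorial sense: the latter is
   Node Leaf a Leaf. The nodes of a tree are represented by the nonempty subtrees hanging from
   them; as soon as the labels are distinct this is a one-to-one correspondence. *)

definition nodes :: "'a tree \<Rightarrow> 'a tree set" where
  "nodes t = subtrees t - {Leaf}"

fun root_label :: "'a tree \<Rightarrow> 'a set" where
  "root_label Leaf = {}"
| "root_label (Node l a r) = {a}"

fun child_labels :: "'a tree \<Rightarrow> 'a set" where
  "child_labels Leaf = {}"
| "child_labels (Node l a r) = root_label l \<union> root_label r"

(* A tree with N nodes whose set of labels is {1..N} is labelled bijectively.
   The condition on the root excludes the empty tree. *)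
definition increasing_tree :: "nat \<Rightarrow> nat tree \<Rightarrow> bool" where
  "increasing_tree N t \<longleftrightarrow>
     size t = N \<and> set_tree t = {1..N} \<and> root_label t = {1} \<and>
     (\<forall>s \<in> nodes t. \<forall>b \<in> child_labels s. value s < b)"

fun rightmost :: "'a tree \<Rightarrow> 'a tree" where
  "rightmost Leaf = Leaf"
| "rightmost (Node l a r) = (if r = Leaf then Node l a r else rightmost r)"

definition complete_tree :: "'a tree \<Rightarrow> bool" where
  "complete_tree t \<longleftrightarrow>
     (\<forall>s \<in> nodes t.
        if even (size t) \<and> s = rightmost t
        then left s \<noteq> Leaf \<and> right s = Leaf
        else (left s = Leaf \<and> right s = Leaf) \<or> (left s \<noteq> Leaf \<and> right s \<noteq> Leaf))"

definition complete_increasing_trees :: "nat \<Rightarrow> nat tree set" where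
  "complete_increasing_trees N = {t. increasing_tree N t \<and> complete_tree t}"

(* The recursion follows the minimal chain: it descends to the child with the smallest label. *)
fun eoc :: "nat tree \<Rightarrow> nat" where
  "eoc Leaf = 0"
| "eoc (Node l a r) =
     (if l = Leaf \<and> r = Leaf then a
      else if r = Leaf then eoc l
      else if l = Leaf then eoc r
      else if value l < value r then eoc l
      else eoc r)"

definition pom :: "nat tree \<Rightarrow> nat" where
  "pom t = (THE p. \<exists>s \<in> nodes t. value s = p \<and> size t \<in> child_labels s)"

(* secant_count N m k is f_N(m,k), so that f_{2n} is secant_count (2 * n). The values are
   integers because of the differences taken below. Each set counted here is finite: there are
   finitely many trees with N nodes and labels in {1..N}. *)
definition secant_count :: "nat \<Rightarrow> nat \<Rightarrow> nat \<Rightarrow> int" where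
  "secant_count N m k =
     (if m \<in> {2..N} \<and> k \<in> {1..N - 1}
      then int (card {t \<in> complete_increasing_trees N. eoc t = m \<and> pom t = k})
      else 0)"

definition Delta_m :: "(nat \<Rightarrow> nat \<Rightarrow> int) \<Rightarrow> nat \<Rightarrow> nat \<Rightarrow> int" where
  "Delta_m g m k = g (m + 1) k - g m k"

definition Delta_k :: "(nat \<Rightarrow> nat \<Rightarrow> int) \<Rightarrow> nat \<Rightarrow> nat \<Rightarrow> int" where
  "Delta_k g m k = g m (k + 1) - g m k"

end

theory Submission
  imports Defs
begin

text \<open>
  Build a secant tree by inserting the labels 1, 2, ... one after the other into the open slots of a
  partial tree, deciding at each insertion whether the new node is a leaf or has two children; the
  rightmost slot is special, being allowed to receive only nodes with children and being left empty
  in the end (the missing right child of the rightmost node). As far as the future is concerned,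
  only the number of open slots matters, together with the state of the minimal chain (before time
  \<open>m = eoc\<close>) and the slots below the node \<open>k = pom\<close> (after time \<open>k\<close>), one of which has to wait for
  the largest label. For \<open>m < k\<close> the two periods do not overlap, so that \<open>f\<^sub>N(m,k)\<close> is obtained by
  applying to \<open>\<delta>\<^sub>0\<close> the operator \<open>T = transfer\<close> of plain insertion \<open>N - 1 - k\<close> times, the operator \<open>M = mark\<close>
  of the insertion of \<open>k\<close>, again \<open>T\<close>, now \<open>k - 1 - m\<close> times, and an operator \<open>W\<^sub>m\<close> for the minimal
  chain, and evaluating at 0. The difference equations become the identities
  \<open>W\<^bsub>m+2\<^esub> - 2 W\<^bsub>m+1\<^esub> T + W\<^sub>m T\<^sup>2 = - 4 W\<^sub>m\<close> and \<open>T\<^sup>2 M - 2 T M T + M T\<^sup>2 = - 4 M\<close>.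
\<close>

section \<open>Partial trees and the insertion of labels\<close>

text \<open>\<open>Slot True\<close> is the special slot, \<open>Tip\<close> a leaf in the combinatorial sense.\<close>

datatype partial_tree = Slot bool | Tip nat | Fork partial_tree nat partial_tree

fun labels :: "partial_tree \<Rightarrow> nat list" where
  "labels (Slot b) = []"
| "labels (Tip a) = [a]"
| "labels (Fork l a r) = a # labels l @ labels r"

fun heap_above :: "nat \<Rightarrow> partial_tree \<Rightarrow> bool" where
  "heap_above x (Slot b) = True"
| "heap_above x (Tip a) = (x < a)"
| "heap_above x (Fork l a r) = (x < a \<and> heap_above a l \<and> heap_above a r)"

text \<open>The flag tells whether the subtree contains the special slot. It is handed down to right
  children only, so the special slot ends the right spine; no \<open>Tip\<close> may stand there
  because the rightmost node of a secant tree has a left child.\<close>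

fun well_slotted :: "bool \<Rightarrow> partial_tree \<Rightarrow> bool" where
  "well_slotted b (Slot c) = (c = b)"
| "well_slotted b (Tip a) = (\<not> b)"
| "well_slotted b (Fork l a r) = (well_slotted False l \<and> well_slotted b r)"

fun insertions :: "nat \<Rightarrow> partial_tree \<Rightarrow> partial_tree list" where
  "insertions c (Slot b) = Fork (Slot False) c (Slot b) # (if b then [] else [Tip c])"
| "insertions c (Tip a) = []"
| "insertions c (Fork l a r) =
     map (\<lambda>l'. Fork l' a r) (insertions c l) @ map (\<lambda>r'. Fork l a r') (insertions c r)"

text \<open>Inverse to the insertion of the largest label. A fork with that label has slots for both
  children, and the right one carries the flag of the slot that was filled.\<close>

fun remove :: "nat \<Rightarrow> partial_tree \<Rightarrow> partial_tree" where
  "remove c (Slot b) = Slot b"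
| "remove c (Tip a) = (if a = c then Slot False else Tip a)"
| "remove c (Fork l a r) = (if a = c then r else Fork (remove c l) a (remove c r))"

definition stage :: "nat \<Rightarrow> partial_tree set" where
  "stage i = {p. well_slotted True p \<and> heap_above 0 p \<and> distinct (labels p) \<and> set (labels p) = {1..i}}"

lemma remove_notin: "c \<notin> set (labels p) \<Longrightarrow> remove c p = p"
  by (induction p) auto

lemma remove_insertion:
  "\<lbrakk>q \<in> set (insertions c p); c \<notin> set (labels p)\<rbrakk> \<Longrightarrow> remove c q = p"
  by (induction p arbitrary: q) (auto simp: remove_notin split: if_splits)

lemma distinct_insertions:
  "c \<notin> set (labels p) \<Longrightarrow> distinct (insertions c p)"
proof (induction p)
  case (Fork l a r)
  \<comment> \<open>The two lists could only share a tree whose left subtree is unchanged, but every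
    modified left subtree contains \<open>c\<close>.\<close>
  have "l' \<noteq> l" if "l' \<in> set (insertions c l)" for l'
  proof -
    have "remove c l' = l" using remove_insertion that Fork by auto
    have "c \<in> set (labels q)" if "q \<in> set (insertions c p)" for p q
      using that by (induction p arbitrary: q) (auto split: if_splits)
    with that Fork show ?thesis by auto
  qed
  with Fork show ?case by (auto simp: distinct_map inj_on_def)
qed auto

lemma set_labels_insertion:
  "q \<in> set (insertions c p) \<Longrightarrow> set (labels q) = insert c (set (labels p))"
  by (induction p arbitrary: q) (auto split: if_splits)

lemma distinct_labels_insertion:
  "\<lbrakk>q \<in> set (insertions c p); c \<notin> set (labels p); distinct (labels p)\<rbrakk> \<Longrightarrow> distinct (labels q)"
  by (induction p arbitrary: q) (auto split: if_splits simp: set_labels_insertion)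

lemma well_slotted_insertion:
  "\<lbrakk>q \<in> set (insertions c p); well_slotted b p\<rbrakk> \<Longrightarrow> well_slotted b q"
  by (induction p arbitrary: q b) (auto split: if_splits)

lemma heap_above_insertion:
  "\<lbrakk>q \<in> set (insertions c p); heap_above x p; x < c; \<forall>a \<in> set (labels p). a < c\<rbrakk> \<Longrightarrow> heap_above x q"
  by (induction p arbitrary: q x) (auto split: if_splits)

lemma heap_above_maximum:
  assumes "heap_above c p" "\<forall>a \<in> set (labels p). a \<le> c" "well_slotted b p"
  shows "p = Slot b"
  using assms by (cases p) auto

text \<open>No label lies below the largest one, so its node is a tip or a fork with two slots,
  which are the shapes created by an insertion. Hence every tree of a nonzero stage has a
  predecessor.\<close>

lemma removal:
  "\<lbrakk>heap_above x q; distinct (labels q); well_slotted b q; c \<in> set (labels q);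
    \<forall>a \<in> set (labels q). a \<le> c\<rbrakk> \<Longrightarrow>
   q \<in> set (insertions c (remove c q)) \<and> heap_above x (remove c q) \<and> distinct (labels (remove c q)) \<and>
   well_slotted b (remove c q) \<and> set (labels (remove c q)) = set (labels q) - {c}"
proof (induction q arbitrary: x b)
  case (Fork l a r)
  consider "a = c" | "a \<noteq> c" "c \<in> set (labels l)" "c \<notin> set (labels r)"
    | "a \<noteq> c" "c \<notin> set (labels l)" "c \<in> set (labels r)"
    using Fork.prems by auto
  then show ?case
  proof cases
    case 1
    then have "l = Slot False" "r = Slot b"
      using Fork.prems heap_above_maximum[of c l] heap_above_maximum[of c r] by auto
    with 1 show ?thesis by simp
  next
    case 2
    have "l \<in> set (insertions c (remove c l)) \<and> heap_above a (remove c l) \<and> distinct (labels (remove c l)) \<and>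
      well_slotted False (remove c l) \<and> set (labels (remove c l)) = set (labels l) - {c}"
      using 2 Fork.prems by (intro Fork.IH(1)) auto
    with 2 Fork.prems show ?thesis by (auto simp: remove_notin)
  next
    case 3
    have "r \<in> set (insertions c (remove c r)) \<and> heap_above a (remove c r) \<and> distinct (labels (remove c r)) \<and>
      well_slotted b (remove c r) \<and> set (labels (remove c r)) = set (labels r) - {c}"
      using 3 Fork.prems by (intro Fork.IH(2)) auto
    with 3 Fork.prems show ?thesis by (auto simp: remove_notin)
  qed
qed auto

lemma stage_0: "stage 0 = {Slot True}"
proof -
  have "p = Slot True" if "well_slotted True p" "labels p = []" for p
    using that by (cases p) auto
  then show ?thesis by (auto simp: stage_def)
qed

lemma stage_Suc: "stage (Suc i) = (\<Union>p \<in> stage i. set (insertions (Suc i) p))"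
proof (intro equalityI subsetI)
  fix q assume q: "q \<in> stage (Suc i)"
  then have *: "q \<in> set (insertions (Suc i) (remove (Suc i) q)) \<and> heap_above 0 (remove (Suc i) q) \<and>
      distinct (labels (remove (Suc i) q)) \<and> well_slotted True (remove (Suc i) q) \<and>
      set (labels (remove (Suc i) q)) = set (labels q) - {Suc i}"
    unfolding stage_def by (intro removal) auto
  moreover have "{1..Suc i} - {Suc i} = {1..i}" by auto
  ultimately have "remove (Suc i) q \<in> stage i" using q by (simp add: stage_def)
  with * show "q \<in> (\<Union>p \<in> stage i. set (insertions (Suc i) p))" by blast
next
  fix q assume "q \<in> (\<Union>p \<in> stage i. set (insertions (Suc i) p))"
  then obtain p where p: "p \<in> stage i" "q \<in> set (insertions (Suc i) p)" by blast
  have "insert (Suc i) {1..i} = {1..Suc i}" by auto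
  then show "q \<in> stage (Suc i)"
    using p set_labels_insertion[OF p(2)] well_slotted_insertion[OF p(2)]
      distinct_labels_insertion[OF p(2)] heap_above_insertion[OF p(2)]
    by (simp add: stage_def)
qed

lemma finite_stage: "finite (stage i)"
  by (induction i) (auto simp: stage_0 stage_Suc)

text \<open>All counting goes through this recursion. Predecessors are unique because
  \<open>remove\<close> recovers them, and the inner sum over a list is accessible to structural
  induction.\<close>

lemma sum_stage_Suc:
  "(\<Sum>q \<in> stage (Suc i). F q) = (\<Sum>p \<in> stage i. \<Sum>q \<leftarrow> insertions (Suc i) p. F q)"
  for F :: "partial_tree \<Rightarrow> int"
proof -
  have fresh: "Suc i \<notin> set (labels p)" if "p \<in> stage i" for p
    using that by (simp add: stage_def)
  have "(\<Sum>q \<in> stage (Suc i). F q) = (\<Sum>p \<in> stage i. \<Sum>q \<in> set (insertions (Suc i) p). F q)"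
    unfolding stage_Suc
  proof (rule sum.UNION_disjoint)
    show "\<forall>p \<in> stage i. \<forall>p' \<in> stage i. p \<noteq> p' \<longrightarrow>
        set (insertions (Suc i) p) \<inter> set (insertions (Suc i) p') = {}"
      using remove_insertion fresh by blast
  qed (auto simp: finite_stage)
  also have "\<dots> = (\<Sum>p \<in> stage i. \<Sum>q \<leftarrow> insertions (Suc i) p. F q)"
    by (intro sum.cong refl) (simp add: sum_list_distinct_conv_sum_set distinct_insertions fresh)
  finally show ?thesis .
qed

section \<open>Counting open slots\<close>

fun open_slots :: "partial_tree \<Rightarrow> nat" where
  "open_slots (Slot b) = (if b then 0 else 1)"
| "open_slots (Tip a) = 0"
| "open_slots (Fork l a r) = open_slots l + open_slots r"

text \<open>Kept apart from \<open>open_slots\<close>, and as a number, so that both counts add up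
  over the two subtrees and one identity covers subtrees with and without the special slot.\<close>

fun special_slots :: "partial_tree \<Rightarrow> nat" where
  "special_slots (Slot b) = (if b then 1 else 0)"
| "special_slots (Tip a) = 0"
| "special_slots (Fork l a r) = special_slots l + special_slots r"

lemma special_slots_well_slotted: "well_slotted b p \<Longrightarrow> special_slots p = of_bool b"
  by (induction p arbitrary: b) auto

text \<open>A fork raises the number of open slots by one, in the special slot as well as elsewhere;
  a tip, allowed in open slots only, lowers it by one.\<close>

lemma sum_open_slots_insertions:
  fixes G :: "nat \<Rightarrow> int"
  shows "(\<Sum>q \<leftarrow> insertions c p. G (open_slots q)) =
    int (open_slots p + special_slots p) * G (open_slots p + 1) + int (open_slots p) * G (open_slots p - 1)"
proof (induction p arbitrary: G)
  case (Fork l a r)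
  \<comment> \<open>Truncated subtraction distorts the argument of \<open>G\<close> only if the
    subtree has no open slots, and then the factor vanishes.\<close>
  have 1: "int (open_slots l) * G (open_slots l - 1 + open_slots r) = int (open_slots l) * G (open_slots l + open_slots r - 1)"
    by (cases "open_slots l") auto
  have 2: "int (open_slots r) * G (open_slots l + (open_slots r - 1)) = int (open_slots r) * G (open_slots l + open_slots r - 1)"
    by (cases "open_slots r") auto
  show ?case
    using Fork.IH(1)[of "\<lambda>j. G (j + open_slots r)"] Fork.IH(2)[of "\<lambda>j. G (open_slots l + j)"] 1 2
    by (auto simp add: comp_def algebra_simps)
qed auto

section \<open>The state of the minimal chain\<close>

datatype chain_state = Closed nat | Open bool

fun is_slot :: "partial_tree \<Rightarrow> bool" where
  "is_slot (Slot b) = True"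
| "is_slot _ = False"

fun root :: "partial_tree \<Rightarrow> nat" where
  "root (Slot b) = 0"
| "root (Tip a) = a"
| "root (Fork l a r) = a"

text \<open>A slot beside a filled child is ignored, since any label it receives later is larger.
  For a fork, \<open>Open b\<close> means that both children of the last node of the chain are
  slots, the right one special if \<open>b\<close> holds.\<close>

fun chain :: "partial_tree \<Rightarrow> chain_state" where
  "chain (Slot b) = Open b"
| "chain (Tip a) = Closed a"
| "chain (Fork l a r) =
     (if is_slot l \<and> is_slot r then Open (r = Slot True)
      else if is_slot r then chain l
      else if is_slot l then chain r
      else if root l < root r then chain l
      else chain r)"

lemma not_slot_insertion: "q \<in> set (insertions c p) \<Longrightarrow> \<not> is_slot q"
  by (cases p) (auto split: if_splits)

lemma root_insertion: "q \<in> set (insertions c p) \<Longrightarrow> root q = (if is_slot p then c else root p)"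
  by (cases p) (auto split: if_splits)

lemma root_in_labels: "\<not> is_slot p \<Longrightarrow> root p \<in> set (labels p)"
  by (cases p) auto

fun head_slots :: "chain_state \<Rightarrow> nat" where
  "head_slots (Closed a) = 0"
| "head_slots (Open b) = (if b then 1 else 2)"

text \<open>Ensures that taking away the slots below the last chain node is never truncated.\<close>

lemma head_slots_le: "\<lbrakk>\<not> is_slot p; well_slotted b p\<rbrakk> \<Longrightarrow> head_slots (chain p) \<le> open_slots p"
proof (induction p arbitrary: b)
  case (Fork l a r)
  show ?case
  proof (cases "is_slot l \<and> is_slot r")
    case True
    with Fork.prems show ?thesis by (cases l; cases r) auto
  next
    case False
    with Fork.IH(1)[of False] Fork.IH(2)[of b] Fork.prems show ?thesis by auto
  qed
qed auto

lemma chain_Fork_left: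
  "\<lbrakk>\<not> is_slot l; is_slot r \<or> root l < root r\<rbrakk> \<Longrightarrow> chain (Fork l a r) = chain l" by auto

lemma chain_Fork_right:
  "\<lbrakk>\<not> is_slot r; is_slot l \<or> root r < root l\<rbrakk> \<Longrightarrow> chain (Fork l a r) = chain r" by auto

text \<open>
  \<open>insertion_step c s V x j\<close> is the sum of \<open>V\<close> over the successors of a partial tree with chain state \<open>x\<close>,
  \<open>j\<close> open slots and \<open>s\<close> special ones. Open chains on and off the right spine have one and two open
  slots below their last node, respectively.
\<close>

fun insertion_step :: "nat \<Rightarrow> nat \<Rightarrow> (chain_state \<Rightarrow> nat \<Rightarrow> int) \<Rightarrow> chain_state \<Rightarrow> nat \<Rightarrow> int" where
  "insertion_step c s V (Closed a) j = int (j + s) * V (Closed a) (j + 1) + int j * V (Closed a) (j - 1)"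
| "insertion_step c s V (Open b) j =
    (if b then (int (j + s) - 1) * V (Open True) (j + 1) + (int j - 1) * V (Open True) (j - 1)
         + V (Open False) (j + 1) + V (Closed c) (j - 1)
     else int (j + s) * V (Open False) (j + 1) + (int j - 2) * V (Open False) (j - 1)
         + 2 * V (Closed c) (j - 1))"

text \<open>The primed numbers belong to the sibling of the subtree that carries the chain:
  insertions into the sibling change the slot count but not the chain state.\<close>

lemma insertion_step_shift:
  assumes "head_slots x \<le> j"
  shows "insertion_step c s (\<lambda>x i. V x (i + j')) x j + (int (j' + s') * V x (j + j' + 1) + int j' * V x (j + j' - 1))
    = insertion_step c (s + s') V x (j + j')"
proof (cases x)
  case (Closed a)
  then show ?thesis by (cases j; cases j') (auto simp: algebra_simps)
next
  case (Open b)
  then obtain i where "j = Suc i" using assms by (cases j) (auto split: if_splits)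
  then show ?thesis using Open by (cases j') (auto simp: algebra_simps)
qed

text \<open>A tip in a slot below the last chain node closes the chain. A fork there keeps it open,
  on the right spine if the slot was special and off it otherwise. All other insertions leave the
  state alone.\<close>

lemma sum_chain_insertions:
  fixes V :: "chain_state \<Rightarrow> nat \<Rightarrow> int"
  assumes "\<not> is_slot p" "well_slotted b p" "distinct (labels p)" "\<forall>a \<in> set (labels p). a < c"
  shows "(\<Sum>q \<leftarrow> insertions c p. V (chain q) (open_slots q)) =
    insertion_step c (special_slots p) V (chain p) (open_slots p)"
  using assms
proof (induction p arbitrary: V b)
  case (Fork l a r)
  note prems = Fork.prems
  have neq: "root l \<noteq> root r" if "\<not> is_slot l" "\<not> is_slot r"
    using that root_in_labels[of l] root_in_labels[of r] prems by auto
  consider "is_slot l" "is_slot r" | "\<not> is_slot l" "is_slot r \<or> root l < root r"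
    | "\<not> is_slot r" "is_slot l \<or> root r < root l"
    using neq by fastforce
  then show ?case
  proof cases
    case 1
    with prems show ?thesis by (cases l; cases r) (auto simp: algebra_simps)
  next
    case 2
    \<comment> \<open>Being larger, a new root \<open>c\<close> in an empty sibling cannot divert
      the chain.\<close>
    have lc: "root l < c" using root_in_labels[of l] 2 prems by auto
    have 3: "chain (Fork l' a r) = chain l'" if "l' \<in> set (insertions c l)" for l'
      using that 2 not_slot_insertion[OF that] root_insertion[OF that] by (intro chain_Fork_left) auto
    have 4: "chain (Fork l a r') = chain l" if "r' \<in> set (insertions c r)" for r'
      using that 2 lc root_insertion[OF that] by (intro chain_Fork_left) auto
    have 5: "chain (Fork l a r) = chain l" using 2 by (intro chain_Fork_left)
    have "(\<Sum>q \<leftarrow> insertions c (Fork l a r). V (chain q) (open_slots q)) =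
        (\<Sum>l' \<leftarrow> insertions c l. V (chain l') (open_slots l' + open_slots r)) +
        (\<Sum>r' \<leftarrow> insertions c r. V (chain l) (open_slots l + open_slots r'))"
      using 3 4 by (simp add: comp_def del: chain.simps cong: map_cong)
    also have "(\<Sum>l' \<leftarrow> insertions c l. V (chain l') (open_slots l' + open_slots r)) =
        insertion_step c (special_slots l) (\<lambda>x i. V x (i + open_slots r)) (chain l) (open_slots l)"
      using 2 prems by (intro Fork.IH(1)) auto
    also have "(\<Sum>r' \<leftarrow> insertions c r. V (chain l) (open_slots l + open_slots r')) =
        int (open_slots r + special_slots r) * V (chain l) (open_slots l + open_slots r + 1)
        + int (open_slots r) * V (chain l) (open_slots l + open_slots r - 1)"
      using sum_open_slots_insertions[of "\<lambda>j. V (chain l) (open_slots l + j)"]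
      by (cases "open_slots r") auto
    finally show ?thesis
      using insertion_step_shift[OF head_slots_le[of l False], of c "special_slots l" V "open_slots r" "special_slots r"]
        2 5 prems by simp
  next
    case 3
    have rc: "root r < c" using root_in_labels[of r] 3 prems by auto
    have 4: "chain (Fork l a r') = chain r'" if "r' \<in> set (insertions c r)" for r'
      using that 3 not_slot_insertion[OF that] root_insertion[OF that] by (intro chain_Fork_right) auto
    have 5: "chain (Fork l' a r) = chain r" if "l' \<in> set (insertions c l)" for l'
      using that 3 rc root_insertion[OF that] by (intro chain_Fork_right) auto
    have 6: "chain (Fork l a r) = chain r" using 3 by (intro chain_Fork_right)
    have "(\<Sum>q \<leftarrow> insertions c (Fork l a r). V (chain q) (open_slots q)) =
        (\<Sum>l' \<leftarrow> insertions c l. V (chain r) (open_slots r + open_slots l')) +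
        (\<Sum>r' \<leftarrow> insertions c r. V (chain r') (open_slots r' + open_slots l))"
      using 4 5 by (simp add: comp_def add.commute del: chain.simps cong: map_cong)
    also have "(\<Sum>r' \<leftarrow> insertions c r. V (chain r') (open_slots r' + open_slots l)) =
        insertion_step c (special_slots r) (\<lambda>x i. V x (i + open_slots l)) (chain r) (open_slots r)"
      using 3 prems by (intro Fork.IH(2)[of b]) auto
    also have "(\<Sum>l' \<leftarrow> insertions c l. V (chain r) (open_slots r + open_slots l')) =
        int (open_slots l + special_slots l) * V (chain r) (open_slots r + open_slots l + 1)
        + int (open_slots l) * V (chain r) (open_slots r + open_slots l - 1)"
      using sum_open_slots_insertions[of "\<lambda>j. V (chain r) (open_slots r + j)"]
      by (cases "open_slots l") auto
    finally show ?thesis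
      using insertion_step_shift[OF head_slots_le[of r b], of c "special_slots r" V "open_slots l" "special_slots l"]
        3 6 prems by (simp add: add.commute)
  qed
qed (auto)

text \<open>A closed chain never changes, and inserting \<open>c\<close> can close an open one only
  at \<open>c\<close>.\<close>

lemma chain_insertion:
  assumes "q \<in> set (insertions c p)" "\<not> is_slot p" "distinct (labels p)" "\<forall>a \<in> set (labels p). a < c" "m \<noteq> c"
  shows "chain q = Closed m \<longleftrightarrow> chain p = Closed m"
  using assms
proof (induction p arbitrary: q)
  case (Fork l a r)
  note prems = Fork.prems
  have neq: "root l \<noteq> root r" if "\<not> is_slot l" "\<not> is_slot r"
    using that root_in_labels[of l] root_in_labels[of r] prems by auto
  consider "is_slot l" "is_slot r" | "\<not> is_slot l" "is_slot r \<or> root l < root r"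
    | "\<not> is_slot r" "is_slot l \<or> root r < root l"
    using neq by fastforce
  then show ?case
  proof cases
    case 1
    with prems show ?thesis by (cases l; cases r) (auto split: if_splits)
  next
    case 2
    have lc: "root l < c" using root_in_labels[of l] 2 prems by auto
    have "chain (Fork l' a r) = chain l'" if "l' \<in> set (insertions c l)" for l'
      using that 2 not_slot_insertion[OF that] root_insertion[OF that] by (intro chain_Fork_left) auto
    moreover have "chain (Fork l a r') = chain l" if "r' \<in> set (insertions c r)" for r'
      using that 2 lc root_insertion[OF that] by (intro chain_Fork_left) auto
    moreover have "chain (Fork l a r) = chain l" using 2 by (intro chain_Fork_left)
    ultimately show ?thesis using prems Fork.IH(1) 2 by (auto simp del: chain.simps)
  next
    case 3
    have rc: "root r < c" using root_in_labels[of r] 3 prems by auto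
    have "chain (Fork l a r') = chain r'" if "r' \<in> set (insertions c r)" for r'
      using that 3 not_slot_insertion[OF that] root_insertion[OF that] by (intro chain_Fork_right) auto
    moreover have "chain (Fork l' a r) = chain r" if "l' \<in> set (insertions c l)" for l'
      using that 3 rc root_insertion[OF that] by (intro chain_Fork_right) auto
    moreover have "chain (Fork l a r) = chain r" using 3 by (intro chain_Fork_right)
    ultimately show ?thesis using prems Fork.IH(2) 3 by (auto simp del: chain.simps)
  qed
qed auto

section \<open>Slots and children below the node \<open>k\<close>\<close>

fun slots_below :: "nat \<Rightarrow> nat \<Rightarrow> partial_tree \<Rightarrow> int" where
  "slots_below k d (Slot b) = of_bool (\<not> b \<and> d = k)"
| "slots_below k d (Tip a) = 0"
| "slots_below k d (Fork l a r) = slots_below k a l + slots_below k a r"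

text \<open>Here and in \<open>slots_below\<close>, \<open>d\<close> is the label just above the
  subtree; at the root it is taken to be \<open>0\<close>, which is not a label in any stage.
  \<open>slots_below\<close> omits the special slot because the largest label, being a leaf, cannot
  enter it.\<close>

fun child_count :: "nat \<Rightarrow> nat \<Rightarrow> nat \<Rightarrow> partial_tree \<Rightarrow> int" where
  "child_count k c d (Slot b) = 0"
| "child_count k c d (Tip a) = of_bool (a = c \<and> d = k)"
| "child_count k c d (Fork l a r) = of_bool (a = c \<and> d = k) + child_count k c a l + child_count k c a r"

lemma slots_below_eq_0: "\<lbrakk>k \<notin> set (labels p); d \<noteq> k\<rbrakk> \<Longrightarrow> slots_below k d p = 0"
  by (induction p arbitrary: d) auto

lemma slots_below_no_slots: "open_slots p = 0 \<Longrightarrow> slots_below k d p = 0"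
  by (induction p arbitrary: d) (auto split: if_splits)

lemma child_count_eq_0: "c \<notin> set (labels p) \<Longrightarrow> child_count k c d p = 0"
  by (induction p arbitrary: d) auto

lemma sum_list_add_mult: "(\<Sum>x \<leftarrow> xs. (a + f x) * g x) = a * (\<Sum>x \<leftarrow> xs. g x) + (\<Sum>x \<leftarrow> xs. f x * g x)"
  for a :: int
  by (induction xs) (auto simp: algebra_simps)

text \<open>Count pairs of an insertion and a slot below \<open>k\<close> that it leaves open. New
  slots hang below \<open>c\<close>, so the chosen slot is an old one, and reserving it costs one
  place for forks and one for tips.\<close>

lemma sum_slots_below_insertions:
  fixes G :: "nat \<Rightarrow> int"
  assumes "c \<noteq> k"
  shows "(\<Sum>q \<leftarrow> insertions c p. slots_below k d q * G (open_slots q)) = slots_below k d p *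
    ((int (open_slots p + special_slots p) - 1) * G (open_slots p + 1) + (int (open_slots p) - 1) * G (open_slots p - 1))"
proof (induction p arbitrary: G d)
  case (Fork l a r)
  have "(\<Sum>q \<leftarrow> insertions c (Fork l a r). slots_below k d q * G (open_slots q)) =
     (\<Sum>q \<leftarrow> insertions c l. (slots_below k a r + slots_below k a q) * G (open_slots q + open_slots r)) +
     (\<Sum>q \<leftarrow> insertions c r. (slots_below k a l + slots_below k a q) * G (open_slots l + open_slots q))"
    by (simp add: comp_def add.commute)
  also have "\<dots> =
     slots_below k a r * (\<Sum>q \<leftarrow> insertions c l. G (open_slots q + open_slots r)) +
     (\<Sum>q \<leftarrow> insertions c l. slots_below k a q * G (open_slots q + open_slots r)) +
     slots_below k a l * (\<Sum>q \<leftarrow> insertions c r. G (open_slots l + open_slots q)) +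
     (\<Sum>q \<leftarrow> insertions c r. slots_below k a q * G (open_slots l + open_slots q))"
    by (simp only: sum_list_add_mult)
  also have "\<dots> = slots_below k d (Fork l a r) *
    ((int (open_slots (Fork l a r) + special_slots (Fork l a r)) - 1) * G (open_slots (Fork l a r) + 1)
     + (int (open_slots (Fork l a r)) - 1) * G (open_slots (Fork l a r) - 1))"
    unfolding Fork.IH(1)[of a "\<lambda>j. G (j + open_slots r)"] Fork.IH(2)[of a "\<lambda>j. G (open_slots l + j)"]
      sum_open_slots_insertions[of "\<lambda>j. G (j + open_slots r)"]
      sum_open_slots_insertions[of "\<lambda>j. G (open_slots l + j)"]
    using slots_below_no_slots[of l k a] slots_below_no_slots[of r k a]
    by (cases "open_slots l"; cases "open_slots r") (simp_all add: algebra_simps)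
  finally show ?case .
qed (use assms in auto)

text \<open>A fork in an open slot creates two open slots below \<open>k\<close>, a fork in the
  special slot one, a tip none.\<close>

lemma sum_slots_below_new:
  fixes G :: "nat \<Rightarrow> int"
  assumes "k \<notin> set (labels p)" "d \<noteq> k"
  shows "(\<Sum>q \<leftarrow> insertions k p. slots_below k d q * G (open_slots q)) =
    int (2 * open_slots p + special_slots p) * G (open_slots p + 1)"
  using assms
proof (induction p arbitrary: G d)
  case (Fork l a r)
  show ?case
    using Fork.IH(1)[of a "\<lambda>j. G (j + open_slots r)"] Fork.IH(2)[of a "\<lambda>j. G (open_slots l + j)"]
      Fork.prems slots_below_eq_0[of k l a] slots_below_eq_0[of k r a]
    by (simp add: comp_def algebra_simps)
qed auto

text \<open>Forks leave an open slot and are discarded by the vanishing of \<open>G\<close>; only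
  tips in slots below \<open>k\<close> survive.\<close>

lemma sum_child_count_insertions:
  fixes G :: "nat \<Rightarrow> int"
  assumes "c \<notin> set (labels p)" "c \<noteq> k" "\<And>j. G (Suc j) = 0"
  shows "(\<Sum>q \<leftarrow> insertions c p. child_count k c d q * G (open_slots q)) =
    slots_below k d p * G (open_slots p - 1)"
  using assms
proof (induction p arbitrary: G d)
  case (Slot b)
  \<comment> \<open>The fork leaves one or two open slots, depending on the flag, and
    \<open>G\<close> vanishes at both.\<close>
  then show ?case using Slot(3)[of 0] Slot(3)[of 1] by (auto simp: numeral_2_eq_2)
next
  case (Fork l a r)
  have 1: "slots_below k a l * G (open_slots l - 1 + open_slots r) = slots_below k a l * G (open_slots l + open_slots r - 1)"
    using slots_below_no_slots[of l k a] by (cases "open_slots l") auto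
  have 2: "slots_below k a r * G (open_slots l + (open_slots r - 1)) = slots_below k a r * G (open_slots l + open_slots r - 1)"
    using slots_below_no_slots[of r k a] by (cases "open_slots r") auto
  have 3: "(\<Sum>q \<leftarrow> insertions c l. child_count k c a q * G (open_slots q + open_slots r)) =
      slots_below k a l * G (open_slots l - 1 + open_slots r)"
    by (intro Fork.IH(1)[of "\<lambda>j. G (j + open_slots r)"]) (use Fork.prems in auto)
  have 4: "(\<Sum>q \<leftarrow> insertions c r. child_count k c a q * G (open_slots l + open_slots q)) =
      slots_below k a r * G (open_slots l + (open_slots r - 1))"
    by (intro Fork.IH(2)[of "\<lambda>j. G (open_slots l + j)"]) (use Fork.prems in auto)
  show ?case using 3 4 1 2 Fork.prems child_count_eq_0[of c l k a] child_count_eq_0[of c r k a]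
    by (auto simp add: comp_def algebra_simps)
qed auto

section \<open>Secant trees as partial trees without open slots\<close>

fun tree_of :: "partial_tree \<Rightarrow> nat tree" where
  "tree_of (Slot b) = \<langle>\<rangle>"
| "tree_of (Tip a) = \<langle>\<langle>\<rangle>, a, \<langle>\<rangle>\<rangle>"
| "tree_of (Fork l a r) = \<langle>tree_of l, a, tree_of r\<rangle>"

fun partial_of :: "bool \<Rightarrow> nat tree \<Rightarrow> partial_tree" where
  "partial_of b \<langle>\<rangle> = Slot b"
| "partial_of b \<langle>l, a, r\<rangle> =
     (if \<not> b \<and> l = \<langle>\<rangle> \<and> r = \<langle>\<rangle> then Tip a else Fork (partial_of False l) a (partial_of b r))"

text \<open>Recursive form of completeness. \<open>full False\<close> describes nonempty trees in
  which every node has no or two children; \<open>full True\<close> makes the right spine end in an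
  absent child, so that the rightmost node has a left child only.\<close>

fun full :: "bool \<Rightarrow> 'a tree \<Rightarrow> bool" where
  "full b \<langle>\<rangle> = b"
| "full b \<langle>l, a, r\<rangle> = (\<not> b \<and> l = \<langle>\<rangle> \<and> r = \<langle>\<rangle> \<or> full False l \<and> full b r)"

fun heap_tree :: "nat \<Rightarrow> nat tree \<Rightarrow> bool" where
  "heap_tree x \<langle>\<rangle> = True"
| "heap_tree x \<langle>l, a, r\<rangle> = (x < a \<and> heap_tree a l \<and> heap_tree a r)"

lemma closed_not_slot: "\<lbrakk>well_slotted False p; open_slots p = 0\<rbrakk> \<Longrightarrow> \<not> is_slot p"
  by (cases p) auto

lemma tree_of_eq_Leaf: "tree_of p = \<langle>\<rangle> \<longleftrightarrow> is_slot p"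
  by (cases p) auto

lemma partial_of_tree_of:
  "\<lbrakk>well_slotted b p; open_slots p = 0\<rbrakk> \<Longrightarrow> partial_of b (tree_of p) = p"
  by (induction p arbitrary: b) (auto simp: tree_of_eq_Leaf closed_not_slot split: if_splits)

lemma full_tree_of:
  "\<lbrakk>well_slotted b p; open_slots p = 0\<rbrakk> \<Longrightarrow> full b (tree_of p)"
  by (induction p arbitrary: b) (auto split: if_splits)

lemma partial_of_full:
  "full b t \<Longrightarrow> well_slotted b (partial_of b t) \<and> open_slots (partial_of b t) = 0 \<and> tree_of (partial_of b t) = t"
  by (induction t arbitrary: b) auto

lemma set_tree_tree_of: "set_tree (tree_of p) = set (labels p)"
  by (induction p) auto

lemma distinct_tree_of: "distinct (inorder (tree_of p)) \<longleftrightarrow> distinct (labels p)"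
  by (induction p) (auto simp: set_tree_tree_of)

lemma heap_tree_of: "heap_tree x (tree_of p) = heap_above x p"
  by (induction p arbitrary: x) auto

lemma nodes_simps:
  "nodes \<langle>\<rangle> = {}"
  "nodes \<langle>l, a, r\<rangle> = insert \<langle>l, a, r\<rangle> (nodes l \<union> nodes r)"
  by (auto simp: nodes_def)

lemma heap_tree_root: "heap_tree x t \<longleftrightarrow> (\<forall>a \<in> root_label t. x < a) \<and> (\<forall>s \<in> nodes t. \<forall>b \<in> child_labels s. value s < b)"
proof (induction t arbitrary: x)
  case (Node l a r)
  show ?case by (auto simp: nodes_simps Node.IH)
qed (auto simp: nodes_simps)

lemma nodes_subset: "s \<in> nodes t \<Longrightarrow> value s \<in> set_tree t \<and> size s \<le> size t"
  by (induction t) (auto simp: nodes_simps)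

lemma rightmost_in_nodes: "t \<noteq> \<langle>\<rangle> \<Longrightarrow> rightmost t \<in> nodes t"
  by (induction t rule: rightmost.induct) (auto simp: nodes_simps)

lemma full_False_iff:
  "t \<noteq> \<langle>\<rangle> \<Longrightarrow> full False t \<longleftrightarrow>
    (\<forall>s \<in> nodes t. (left s = \<langle>\<rangle> \<and> right s = \<langle>\<rangle>) \<or> (left s \<noteq> \<langle>\<rangle> \<and> right s \<noteq> \<langle>\<rangle>))"
proof (induction t)
  case (Node l a r)
  then show ?case by (cases "l = \<langle>\<rangle>"; cases "r = \<langle>\<rangle>") (auto simp: nodes_simps)
qed simp

text \<open>Nodes are subtrees, so distinct labels are what prevents a copy of the rightmost node
  from occurring in a left subtree.\<close>

lemma full_True_iff:
  "\<lbrakk>t \<noteq> \<langle>\<rangle>; distinct (inorder t)\<rbrakk> \<Longrightarrow> full True t \<longleftrightarrow>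
    (\<forall>s \<in> nodes t. if s = rightmost t then left s \<noteq> \<langle>\<rangle> \<and> right s = \<langle>\<rangle>
       else (left s = \<langle>\<rangle> \<and> right s = \<langle>\<rangle>) \<or> (left s \<noteq> \<langle>\<rangle> \<and> right s \<noteq> \<langle>\<rangle>))"
proof (induction t)
  case (Node l a r)
  have small: "s \<noteq> \<langle>l, a, r\<rangle>" if "s \<in> nodes l \<or> s \<in> nodes r" for s
    using that nodes_subset[of s l] nodes_subset[of s r] by auto
  show ?case
  proof (cases "r = \<langle>\<rangle>")
    case True
    show ?thesis
    proof (cases "l = \<langle>\<rangle>")
      case False
      then show ?thesis using True small full_False_iff[of l] by (auto simp: nodes_simps)
    qed (simp add: True nodes_simps)
  next
    case False
    have "s \<noteq> rightmost r" if "s \<in> nodes l" for s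
      using nodes_subset[OF that] nodes_subset[OF rightmost_in_nodes[OF False]] Node.prems by auto
    moreover have "\<langle>l, a, r\<rangle> \<noteq> rightmost r"
      using small[of "rightmost r"] rightmost_in_nodes[OF False] by auto
    moreover have "full True r \<longleftrightarrow> (\<forall>s \<in> nodes r. if s = rightmost r then left s \<noteq> \<langle>\<rangle> \<and> right s = \<langle>\<rangle>
       else (left s = \<langle>\<rangle> \<and> right s = \<langle>\<rangle>) \<or> (left s \<noteq> \<langle>\<rangle> \<and> right s \<noteq> \<langle>\<rangle>))"
      using Node False by simp
    ultimately show ?thesis
      using False full_False_iff[of l] by (cases "l = \<langle>\<rangle>") (auto simp: nodes_simps)
  qed
qed simp

lemma distinct_inorder_iff: "finite A \<Longrightarrow> set_tree t = A \<Longrightarrow> distinct (inorder t) \<longleftrightarrow> size t = card A"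
  using card_distinct[of "inorder t"] distinct_card[of "inorder t"] by auto

lemma complete_increasing_trees_even:
  assumes "even N" "N > 0"
  shows "complete_increasing_trees N =
    {t. full True t \<and> heap_tree 0 t \<and> distinct (inorder t) \<and> set_tree t = {1..N}}"
proof -
  have "t \<in> complete_increasing_trees N \<longleftrightarrow>
      full True t \<and> heap_tree 0 t \<and> distinct (inorder t) \<and> set_tree t = {1..N}" for t
  proof (cases "set_tree t = {1..N} \<and> size t = N")
    case False
    then show ?thesis using distinct_inorder_iff[of "{1..N}" t]
      by (auto simp: complete_increasing_trees_def increasing_tree_def)
  next
    case True
    then have d: "distinct (inorder t)" using distinct_inorder_iff[of "{1..N}" t] by simp
    have ne: "t \<noteq> \<langle>\<rangle>" using True assms by auto
    have "complete_tree t \<longleftrightarrow> full True t"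
      using full_True_iff[OF ne d] True assms by (simp add: complete_tree_def)
    moreover have "increasing_tree N t \<longleftrightarrow> heap_tree 0 t"
    proof -
      \<comment> \<open>Labels below the root exceed the root label, which is positive, so
        \<open>1\<close> can only be at the root.\<close>
      have "root_label t = {1}" if "heap_tree 0 t"
      proof -
        obtain l a r where t: "t = \<langle>l, a, r\<rangle>" using ne by (cases t) auto
        have above: "x < b" if "heap_tree x s" "b \<in> set_tree s" for x b s
          using that by (induction s arbitrary: x) (auto intro: less_trans)
        have "1 \<in> set_tree t" using True assms by simp
        moreover have "b > 1" if "b \<in> set_tree l \<union> set_tree r" for b
          using that \<open>heap_tree 0 t\<close> above[of a l b] above[of a r b] t by auto
        ultimately show ?thesis using t by auto
      qed
      moreover have "\<forall>a \<in> root_label t. 0 < a" if "root_label t = {1}" using that by simp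
      ultimately show ?thesis
        unfolding increasing_tree_def using True heap_tree_root[of 0 t] by blast
    qed
    ultimately show ?thesis using True d by (auto simp: complete_increasing_trees_def)
  qed
  then show ?thesis by blast
qed

text \<open>The inverse map is \<open>partial_of True\<close>. The only remaining slot is the
  special one, which becomes the missing right child.\<close>

lemma bij_betw_tree_of:
  assumes "even N" "N > 0"
  shows "bij_betw tree_of {q \<in> stage N. open_slots q = 0} (complete_increasing_trees N)"
proof (rule bij_betwI')
  show "tree_of p = tree_of q \<longleftrightarrow> p = q"
    if "p \<in> {q \<in> stage N. open_slots q = 0}" "q \<in> {q \<in> stage N. open_slots q = 0}" for p q
  proof -
    have "partial_of True (tree_of p) = p" "partial_of True (tree_of q) = q"
      using that by (auto simp: stage_def intro!: partial_of_tree_of)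
    then show ?thesis by metis
  qed
  show "tree_of q \<in> complete_increasing_trees N" if "q \<in> {q \<in> stage N. open_slots q = 0}" for q
    using that distinct_tree_of full_tree_of[of True q]
    by (auto simp: stage_def complete_increasing_trees_even[OF assms] heap_tree_of set_tree_tree_of)
  show "\<exists>q \<in> {q \<in> stage N. open_slots q = 0}. t = tree_of q" if "t \<in> complete_increasing_trees N" for t
  proof
    have t: "full True t" "heap_tree 0 t" "distinct (inorder t)" "set_tree t = {1..N}"
      using that by (auto simp: complete_increasing_trees_even[OF assms])
    show "t = tree_of (partial_of True t)" using partial_of_full[OF t(1)] by simp
    show "partial_of True t \<in> {q \<in> stage N. open_slots q = 0}"
      using partial_of_full[OF t(1)] t distinct_tree_of[of "partial_of True t"]
        set_tree_tree_of[of "partial_of True t"] heap_tree_of[of 0 "partial_of True t"]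
      by (simp add: stage_def)
  qed
qed

section \<open>The statistics \<open>eoc\<close> and \<open>pom\<close> on partial trees\<close>

lemma value_tree_of: "\<not> is_slot p \<Longrightarrow> value (tree_of p) = root p"
  by (cases p) auto

lemma chain_eoc:
  "\<lbrakk>well_slotted b p; open_slots p = 0; \<not> is_slot p\<rbrakk> \<Longrightarrow> chain p = Closed (eoc (tree_of p))"
proof (induction p arbitrary: b)
  case (Fork l a r)
  then have "\<not> is_slot l" using closed_not_slot by simp
  with Fork show ?case by (cases "is_slot r") (auto simp: tree_of_eq_Leaf value_tree_of)
qed auto

definition parent :: "'a tree \<Rightarrow> 'a \<Rightarrow> 'a \<Rightarrow> bool" where
  "parent t k c \<longleftrightarrow> (\<exists>s \<in> nodes t. value s = k \<and> c \<in> child_labels s)"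

lemma parent_simps:
  "\<not> parent \<langle>\<rangle> k c"
  "parent \<langle>l, a, r\<rangle> k c \<longleftrightarrow> (a = k \<and> c \<in> root_label l \<union> root_label r) \<or> parent l k c \<or> parent r k c"
  by (auto simp: parent_def nodes_simps)

lemma root_label_subset: "c \<in> root_label t \<Longrightarrow> c \<in> set_tree t"
  by (cases t) auto

lemma parent_child: "parent t k c \<Longrightarrow> c \<in> set_tree t"
  by (induction t) (auto simp: parent_simps root_label_subset)

lemma parent_root: "distinct (inorder t) \<Longrightarrow> c \<in> root_label t \<Longrightarrow> \<not> parent t k c"
  by (cases t) (auto simp: parent_simps dest: root_label_subset parent_child)

text \<open>Needed to resolve the definite description in \<open>pom\<close>. A label with a parent
  inside one subtree is the root of neither subtree and has no parent in the other.\<close>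

lemma parent_unique:
  "\<lbrakk>distinct (inorder t); parent t k c; parent t k' c\<rbrakk> \<Longrightarrow> k = k'"
proof (induction t)
  case (Node l a r)
  have disj: "set_tree l \<inter> set_tree r = {}" and dl: "distinct (inorder l)" and dr: "distinct (inorder r)"
    using Node.prems by auto
  have l: "c \<notin> root_label l \<and> c \<notin> root_label r \<and> \<not> parent r x' c" if "parent l x c" for x x'
    using that disj parent_root[OF dl] root_label_subset[of c r] parent_child by fastforce
  have r: "c \<notin> root_label l \<and> c \<notin> root_label r \<and> \<not> parent l x' c" if "parent r x c" for x x'
    using that disj parent_root[OF dr] root_label_subset[of c l] parent_child by fastforce
  show ?case
    using Node.prems(2,3) Node.IH(1)[OF dl] Node.IH(2)[OF dr] l r unfolding parent_simps by blast
qed (simp add: parent_simps)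

lemma parent_exists:
  "\<lbrakk>c \<in> set_tree t; c \<notin> root_label t\<rbrakk> \<Longrightarrow> \<exists>k. parent t k c"
  by (induction t) (auto simp: parent_simps)

lemma pom_eq_iff:
  assumes "distinct (inorder t)" "size t \<in> set_tree t" "size t \<notin> root_label t"
  shows "pom t = k \<longleftrightarrow> parent t k (size t)"
proof -
  obtain k' where k': "parent t k' (size t)" using parent_exists[OF assms(2,3)] by blast
  have "pom t = (THE p. parent t p (size t))" by (simp add: pom_def parent_def)
  also have "\<dots> = k'" using k' parent_unique[OF assms(1) _ k'] by (rule the_equality)
  finally show ?thesis using k' parent_unique[OF assms(1) _ k'] by blast
qed

text \<open>Distinct labels make the count at most one. The first disjunct concerns the root, whose
  parent is \<open>d\<close> by convention.\<close>

lemma child_count_parent: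
  "distinct (labels q) \<Longrightarrow> child_count k c d q =
     of_bool (c \<in> root_label (tree_of q) \<and> d = k \<or> parent (tree_of q) k c)"
proof (induction q arbitrary: d)
  case (Fork l a r)
  have sub: "c \<in> set (labels p)" if "c \<in> root_label (tree_of p) \<or> parent (tree_of p) k c" for p
    using that root_label_subset parent_child set_tree_tree_of by metis
  consider "c \<notin> set (labels l)" "c \<notin> set (labels r)"
    | "c \<in> set (labels l)" "c \<notin> set (labels r)" "a \<noteq> c"
    | "c \<notin> set (labels l)" "c \<in> set (labels r)" "a \<noteq> c"
    using Fork.prems by auto
  then show ?case
  proof cases
    case 1
    then have "c \<notin> root_label (tree_of l)" "\<not> parent (tree_of l) k c"
      "c \<notin> root_label (tree_of r)" "\<not> parent (tree_of r) k c" using sub by blast+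
    with 1 show ?thesis by (simp add: parent_simps child_count_eq_0 eq_commute[of a c])
  next
    case 2
    then have "c \<notin> root_label (tree_of r)" "\<not> parent (tree_of r) k c" using sub by blast+
    with 2 show ?thesis using Fork.IH(1)[of a] Fork.prems
      by (auto simp add: parent_simps child_count_eq_0)
  next
    case 3
    then have "c \<notin> root_label (tree_of l)" "\<not> parent (tree_of l) k c" using sub by blast+
    with 3 show ?thesis using Fork.IH(2)[of a] Fork.prems
      by (auto simp add: parent_simps child_count_eq_0)
  qed
qed (auto simp: parent_simps)

lemma secant_count_stage:
  assumes "even N" "2 \<le> m" "m \<le> N" "1 \<le> k" "k \<le> N - 1"
  shows "secant_count N m k =
    (\<Sum>q \<in> stage N. of_bool (chain q = Closed m) * (child_count k N 0 q * of_bool (open_slots q = 0)))"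
proof -
  let ?Q = "{q \<in> stage N. open_slots q = 0}"
  let ?P = "\<lambda>t. eoc t = m \<and> pom t = k"
  have N: "N \<ge> 2" using assms by simp
  have "bij_betw tree_of ?Q (complete_increasing_trees N)"
    by (rule bij_betw_tree_of) (use assms in auto)
  then have inj: "inj_on tree_of ?Q" and im: "complete_increasing_trees N = tree_of ` ?Q"
    by (auto simp: bij_betw_def)
  have "{t \<in> complete_increasing_trees N. ?P t} = tree_of ` {q \<in> ?Q. ?P (tree_of q)}"
    unfolding im by blast
  moreover have "inj_on tree_of {q \<in> ?Q. ?P (tree_of q)}" using inj by (rule inj_on_subset) auto
  ultimately have "secant_count N m k = int (card {q \<in> ?Q. ?P (tree_of q)})"
    using assms by (simp add: secant_count_def card_image)
  also have "\<dots> = (\<Sum>q \<in> stage N. of_bool (open_slots q = 0 \<and> ?P (tree_of q)))"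
    using finite_stage[of N] by (simp add: sum_of_bool_eq Int_def conj_assoc)
  also have "\<dots> = (\<Sum>q \<in> stage N. of_bool (chain q = Closed m) * (child_count k N 0 q * of_bool (open_slots q = 0)))"
  proof (rule sum.cong[OF refl])
    fix q assume q: "q \<in> stage N"
    show "of_bool (open_slots q = 0 \<and> ?P (tree_of q)) =
      (of_bool (chain q = Closed m) * (child_count k N 0 q * of_bool (open_slots q = 0)) :: int)"
    proof (cases "open_slots q = 0")
      case True
      have t: "tree_of q \<in> complete_increasing_trees N" using im q True by blast
      then have inc: "size (tree_of q) = N" "set_tree (tree_of q) = {1..N}" "root_label (tree_of q) = {1}"
        by (auto simp: complete_increasing_trees_def increasing_tree_def)
      have "distinct (inorder (tree_of q))"
        using distinct_inorder_iff[OF _ inc(2)] inc(1) by simp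
      then have "pom (tree_of q) = k \<longleftrightarrow> parent (tree_of q) k N"
        using pom_eq_iff[of "tree_of q" k] inc N by auto
      moreover have "\<not> is_slot q" using inc N by (cases q) auto
      then have "chain q = Closed (eoc (tree_of q))"
        using chain_eoc[of True q] q True by (auto simp: stage_def)
      moreover have "child_count k N 0 q = of_bool (parent (tree_of q) k N)"
        using child_count_parent[of q k N 0] q inc N by (auto simp: stage_def)
      ultimately show ?thesis using True by auto
    qed simp
  qed
  finally show ?thesis .
qed

section \<open>Operators on weights\<close>

text \<open>
  In the operators below the argument counts the open slots that do not matter otherwise: for
  \<open>transfer\<close> and \<open>mark\<close> all of them (after time \<open>k\<close>: except the one waiting for the largest label), in
  the two components of \<open>chain_step\<close> those not below the last node of the minimal chain, which lies
  on the right spine for the first component and off it for the second.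
\<close>

type_synonym weight = "nat \<Rightarrow> int"

definition transfer :: "weight \<Rightarrow> weight" where
  "transfer g j = (int j + 1) * g (j + 1) + int j * g (j - 1)"

definition mark :: "weight \<Rightarrow> weight" where
  "mark g j = (2 * int j + 1) * g j"

definition chain_transfer :: "weight \<Rightarrow> weight" where
  "chain_transfer g j = (int j + 3) * g (j + 1) + int j * g (j - 1)"

fun chain_step :: "weight \<times> weight \<Rightarrow> weight \<times> weight" where
  "chain_step (a, b) = ((\<lambda>j. transfer a j + b j), chain_transfer b)"

definition chain_start :: "weight \<Rightarrow> weight \<times> weight" where
  "chain_start g = (g, \<lambda>j. 2 * g (j + 1))"

definition delta :: weight where
  "delta j = of_bool (j = 0)"

text \<open>A chain that has closed too early cannot end at the prescribed label, hence the weight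
  0. The subtractions remove the slots below the last chain node.\<close>

fun chain_weight :: "weight \<times> weight \<Rightarrow> chain_state \<Rightarrow> nat \<Rightarrow> int" where
  "chain_weight X (Closed a) j = 0"
| "chain_weight X (Open b) j = (if b then fst X (j - 1) else snd X (j - 2))"

section \<open>Passing weighted sums from one stage to the previous one\<close>

lemma stage_not_slot: "\<lbrakk>p \<in> stage i; i \<ge> 1\<rbrakk> \<Longrightarrow> \<not> is_slot p"
  by (cases p) (auto simp: stage_def)

lemma stage_special_slots: "p \<in> stage i \<Longrightarrow> special_slots p = 1"
  using special_slots_well_slotted[of True p] by (simp add: stage_def)

lemma sum_closed_chain:
  fixes F :: "partial_tree \<Rightarrow> int"
  assumes "1 \<le> i" "m \<le> i"
  shows "(\<Sum>q \<in> stage (Suc i). of_bool (chain q = Closed m) * F q) =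
    (\<Sum>p \<in> stage i. of_bool (chain p = Closed m) * (\<Sum>q \<leftarrow> insertions (Suc i) p. F q))"
  unfolding sum_stage_Suc
proof (rule sum.cong[OF refl])
  fix p assume p: "p \<in> stage i"
  have "chain q = Closed m \<longleftrightarrow> chain p = Closed m" if "q \<in> set (insertions (Suc i) p)" for q
    using that p assms by (intro chain_insertion[of q "Suc i"]) (auto simp: stage_not_slot, auto simp: stage_def)
  then show "(\<Sum>q \<leftarrow> insertions (Suc i) p. of_bool (chain q = Closed m) * F q) =
      of_bool (chain p = Closed m) * (\<Sum>q \<leftarrow> insertions (Suc i) p. F q)"
    by (simp add: sum_list_const_mult cong: map_cong)
qed

lemma sum_last_insertion:
  assumes "1 \<le> i" "m \<le> i" "1 \<le> k" "k \<le> i"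
  shows "(\<Sum>q \<in> stage (Suc i). of_bool (chain q = Closed m) * (child_count k (Suc i) 0 q * of_bool (open_slots q = 0))) =
    (\<Sum>p \<in> stage i. of_bool (chain p = Closed m) * (slots_below k 0 p * delta (open_slots p - 1)))"
  unfolding sum_closed_chain[OF assms(1,2)]
proof (rule sum.cong[OF refl])
  fix p assume p: "p \<in> stage i"
  show "of_bool (chain p = Closed m) * (\<Sum>q \<leftarrow> insertions (Suc i) p. child_count k (Suc i) 0 q * of_bool (open_slots q = 0)) =
      of_bool (chain p = Closed m) * (slots_below k 0 p * delta (open_slots p - 1))"
    using sum_child_count_insertions[of "Suc i" p k "\<lambda>j. of_bool (j = 0)" 0] p assms
    by (auto simp: delta_def stage_def)
qed

text \<open>Leaving the reserved slot out of the count turns the coefficients of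
  \<open>sum_slots_below_insertions\<close> into those of plain insertion, so
  \<open>transfer\<close> serves after time \<open>k\<close> as well.\<close>

lemma sum_slots_below_step:
  assumes "1 \<le> i" "m \<le> i" "1 \<le> k" "k \<le> i"
  shows "(\<Sum>q \<in> stage (Suc i). of_bool (chain q = Closed m) * (slots_below k 0 q * w (open_slots q - 1))) =
    (\<Sum>p \<in> stage i. of_bool (chain p = Closed m) * (slots_below k 0 p * transfer w (open_slots p - 1)))"
  unfolding sum_closed_chain[OF assms(1,2)]
proof (rule sum.cong[OF refl])
  fix p assume p: "p \<in> stage i"
  show "of_bool (chain p = Closed m) * (\<Sum>q \<leftarrow> insertions (Suc i) p. slots_below k 0 q * w (open_slots q - 1)) =
      of_bool (chain p = Closed m) * (slots_below k 0 p * transfer w (open_slots p - 1))"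
    using sum_slots_below_insertions[of "Suc i" k 0 "\<lambda>j. w (j - 1)" p] assms
      slots_below_no_slots[of p k 0] stage_special_slots[OF p]
    by (cases "open_slots p") (auto simp: transfer_def)
qed

lemma sum_slots_below_start:
  assumes "1 \<le> i" "m \<le> i"
  shows "(\<Sum>q \<in> stage (Suc i). of_bool (chain q = Closed m) * (slots_below (Suc i) 0 q * w (open_slots q - 1))) =
    (\<Sum>p \<in> stage i. of_bool (chain p = Closed m) * mark w (open_slots p))"
  unfolding sum_closed_chain[OF assms]
proof (rule sum.cong[OF refl])
  fix p assume p: "p \<in> stage i"
  show "of_bool (chain p = Closed m) * (\<Sum>q \<leftarrow> insertions (Suc i) p. slots_below (Suc i) 0 q * w (open_slots q - 1)) =
      of_bool (chain p = Closed m) * mark w (open_slots p)"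
    using sum_slots_below_new[of "Suc i" p 0 "\<lambda>j. w (j - 1)"] p stage_special_slots[OF p]
    by (simp add: mark_def stage_def)
qed

lemma sum_closed_step:
  assumes "1 \<le> i" "m \<le> i"
  shows "(\<Sum>q \<in> stage (Suc i). of_bool (chain q = Closed m) * g (open_slots q)) =
    (\<Sum>p \<in> stage i. of_bool (chain p = Closed m) * transfer g (open_slots p))"
  unfolding sum_closed_chain[OF assms]
  by (intro sum.cong refl) (simp add: sum_open_slots_insertions stage_special_slots transfer_def)

lemma chain_in_labels: "chain p = Closed a \<Longrightarrow> a \<in> set (labels p)"
  by (induction p) (auto split: if_splits)

lemma sum_chain_stage:
  assumes "1 \<le> i"
  shows "(\<Sum>q \<in> stage (Suc i). V (chain q) (open_slots q)) =
    (\<Sum>p \<in> stage i. insertion_step (Suc i) 1 V (chain p) (open_slots p))"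
  unfolding sum_stage_Suc
proof (rule sum.cong[OF refl])
  fix p assume p: "p \<in> stage i"
  then show "(\<Sum>q \<leftarrow> insertions (Suc i) p. V (chain q) (open_slots q)) =
      insertion_step (Suc i) 1 V (chain p) (open_slots p)"
    using sum_chain_insertions[of p True "Suc i" V] stage_not_slot[OF p] stage_special_slots[OF p] assms
    by (simp add: stage_def)
qed

lemma stage_head_slots: "\<lbrakk>p \<in> stage i; 1 \<le> i\<rbrakk> \<Longrightarrow> head_slots (chain p) \<le> open_slots p"
  using head_slots_le[of p True] stage_not_slot by (auto simp: stage_def)

text \<open>Off the right spine, with \<open>j\<close> open slots elsewhere, a fork has
  \<open>j + 3\<close> places: these, the two below the last chain node, and the special one. Tips
  are confined to the \<open>j\<close>, as others would close the chain. On the spine, the summand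
  \<open>b j\<close> is the fork in the left slot, which takes the chain off the spine.\<close>

lemma sum_chain_weight_step:
  assumes "1 \<le> i"
  shows "(\<Sum>q \<in> stage (Suc i). chain_weight X (chain q) (open_slots q)) =
    (\<Sum>p \<in> stage i. chain_weight (chain_step X) (chain p) (open_slots p))"
  unfolding sum_chain_stage[OF assms, of "chain_weight X"]
proof (rule sum.cong[OF refl])
  fix p assume "p \<in> stage i"
  then have *: "head_slots (chain p) \<le> open_slots p" using stage_head_slots assms by blast
  show "insertion_step (Suc i) 1 (chain_weight X) (chain p) (open_slots p) = chain_weight (chain_step X) (chain p) (open_slots p)"
  proof (cases "chain p")
    case (Open b)
    define j where "j = open_slots p - head_slots (chain p)"
    with * have "open_slots p = j + (if b then 1 else 2)" using Open by simp
    with Open show ?thesis by (cases X) (auto simp: transfer_def chain_transfer_def algebra_simps)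
  qed simp
qed

text \<open>The chain closes at the new label by a tip in an open slot below its last node: one
  choice on the right spine, two off it, where the other slot stays open.\<close>

lemma sum_chain_weight_start:
  assumes "1 \<le> i"
  shows "(\<Sum>q \<in> stage (Suc i). of_bool (chain q = Closed (Suc i)) * g (open_slots q)) =
    (\<Sum>p \<in> stage i. chain_weight (chain_start g) (chain p) (open_slots p))"
  unfolding sum_chain_stage[OF assms, of "\<lambda>x j. of_bool (x = Closed (Suc i)) * g j"]
proof (rule sum.cong[OF refl])
  fix p assume p: "p \<in> stage i"
  then have *: "head_slots (chain p) \<le> open_slots p" using stage_head_slots assms by blast
  show "insertion_step (Suc i) 1 (\<lambda>x j. of_bool (x = Closed (Suc i)) * g j) (chain p) (open_slots p) =
    chain_weight (chain_start g) (chain p) (open_slots p)"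
  proof (cases "chain p")
    case (Closed a)
    then have "a \<noteq> Suc i" using chain_in_labels[OF Closed] p by (auto simp: stage_def)
    with Closed show ?thesis by simp
  next
    case (Open b)
    define j where "j = open_slots p - head_slots (chain p)"
    with * have "open_slots p = j + (if b then 1 else 2)" using Open by simp
    with Open show ?thesis by (auto simp: chain_start_def)
  qed
qed

text \<open>The label 1 enters the special slot, hence as a fork whose only open slot is below the
  last chain node.\<close>

lemma sum_chain_weight_stage_1:
  "(\<Sum>p \<in> stage 1. chain_weight X (chain p) (open_slots p)) = fst X 0"
  using stage_Suc[of 0] by (simp add: stage_0)

lemma sum_slots_below_iterate:
  assumes "m \<le> k" "1 \<le> k"
  shows "(\<Sum>q \<in> stage (k + d). of_bool (chain q = Closed m) * (slots_below k 0 q * w (open_slots q - 1))) =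
    (\<Sum>p \<in> stage k. of_bool (chain p = Closed m) * (slots_below k 0 p * (transfer ^^ d) w (open_slots p - 1)))"
proof (induction d arbitrary: w)
  case (Suc d)
  then show ?case using sum_slots_below_step[of "k + d" m k w] assms by (simp add: funpow_swap1)
qed simp

lemma sum_closed_iterate:
  assumes "1 \<le> m"
  shows "(\<Sum>q \<in> stage (m + d). of_bool (chain q = Closed m) * g (open_slots q)) =
    (\<Sum>p \<in> stage m. of_bool (chain p = Closed m) * (transfer ^^ d) g (open_slots p))"
proof (induction d arbitrary: g)
  case (Suc d)
  then show ?case using sum_closed_step[of "m + d" m g] assms by (simp add: funpow_swap1)
qed simp

lemma sum_chain_weight_iterate:
  "(\<Sum>q \<in> stage (Suc d). chain_weight X (chain q) (open_slots q)) = fst ((chain_step ^^ d) X) 0"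
proof (induction d arbitrary: X)
  case (Suc d)
  then show ?case using sum_chain_weight_step[of "Suc d" X] by (simp add: funpow_swap1)
qed (simp add: sum_chain_weight_stage_1[simplified])

text \<open>The stages are descended from \<open>N - 1\<close> to \<open>k\<close>, from
  \<open>k - 1\<close> to \<open>m\<close> and from \<open>m - 1\<close> to \<open>1\<close>, the
  labels \<open>N\<close>, \<open>k\<close> and \<open>m\<close> being treated separately; this
  gives the exponents.\<close>

lemma secant_count_formula:
  assumes "even N" "2 \<le> m" "m < k" "k < N"
  shows "secant_count N m k =
    fst ((chain_step ^^ (m - 2)) (chain_start ((transfer ^^ (k - 1 - m)) (mark ((transfer ^^ (N - 1 - k)) delta))))) 0"
proof -
  define w where "w = (transfer ^^ (N - 1 - k)) delta"
  define g where "g = (transfer ^^ (k - 1 - m)) (mark w)"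
  have N: "Suc (N - 1) = N" "k + (N - 1 - k) = N - 1" "Suc (k - 1) = k" "m + (k - 1 - m) = k - 1"
    "Suc (m - 1) = m" "Suc (m - 2) = m - 1" using assms by auto
  have "secant_count N m k =
    (\<Sum>q \<in> stage N. of_bool (chain q = Closed m) * (child_count k N 0 q * of_bool (open_slots q = 0)))"
    using assms by (intro secant_count_stage) auto
  also have "\<dots> = (\<Sum>p \<in> stage (N - 1). of_bool (chain p = Closed m) * (slots_below k 0 p * delta (open_slots p - 1)))"
    using sum_last_insertion[of "N - 1" m k] assms unfolding N by simp
  also have "\<dots> = (\<Sum>p \<in> stage k. of_bool (chain p = Closed m) * (slots_below k 0 p * w (open_slots p - 1)))"
    using sum_slots_below_iterate[of m k delta "N - 1 - k"] assms unfolding N w_def by simp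
  also have "\<dots> = (\<Sum>p \<in> stage (k - 1). of_bool (chain p = Closed m) * mark w (open_slots p))"
    using sum_slots_below_start[of "k - 1" m w] assms unfolding N by simp
  also have "\<dots> = (\<Sum>p \<in> stage m. of_bool (chain p = Closed m) * g (open_slots p))"
    using sum_closed_iterate[of m "mark w" "k - 1 - m"] assms unfolding N g_def by simp
  also have "\<dots> = (\<Sum>p \<in> stage (m - 1). chain_weight (chain_start g) (chain p) (open_slots p))"
    using sum_chain_weight_start[of "m - 1" g] assms unfolding N by simp
  also have "\<dots> = fst ((chain_step ^^ (m - 2)) (chain_start g)) 0"
    using sum_chain_weight_iterate[of "chain_start g" "m - 2"] unfolding N .
  finally show ?thesis unfolding g_def w_def .
qed

section \<open>Linearity and the two operator identities\<close>

text \<open>Second differences are kept as a relation between four weights, which every linear operator preserves.\<close>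

definition second_difference :: "weight \<Rightarrow> weight \<Rightarrow> weight \<Rightarrow> weight \<Rightarrow> bool" where
  "second_difference x y z u \<longleftrightarrow> (\<forall>j. x j - 2 * y j + z j + 4 * u j = 0)"

lemma second_difference_transfer:
  assumes "second_difference x y z u"
  shows "second_difference (transfer x) (transfer y) (transfer z) (transfer u)"
proof -
  have "transfer x j - 2 * transfer y j + transfer z j + 4 * transfer u j =
    (int j + 1) * (x (j + 1) - 2 * y (j + 1) + z (j + 1) + 4 * u (j + 1)) +
    int j * (x (j - 1) - 2 * y (j - 1) + z (j - 1) + 4 * u (j - 1))" for j
    by (simp add: transfer_def algebra_simps)
  then show ?thesis using assms by (simp add: second_difference_def)
qed

lemma second_difference_chain_transfer:
  assumes "second_difference x y z u"
  shows "second_difference (chain_transfer x) (chain_transfer y) (chain_transfer z) (chain_transfer u)"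
proof -
  have "chain_transfer x j - 2 * chain_transfer y j + chain_transfer z j + 4 * chain_transfer u j =
    (int j + 3) * (x (j + 1) - 2 * y (j + 1) + z (j + 1) + 4 * u (j + 1)) +
    int j * (x (j - 1) - 2 * y (j - 1) + z (j - 1) + 4 * u (j - 1))" for j
    by (simp add: chain_transfer_def algebra_simps)
  then show ?thesis using assms by (simp add: second_difference_def)
qed

lemma second_difference_add:
  "\<lbrakk>second_difference x y z u; second_difference x' y' z' u'\<rbrakk> \<Longrightarrow>
   second_difference (\<lambda>j. x j + x' j) (\<lambda>j. y j + y' j) (\<lambda>j. z j + z' j) (\<lambda>j. u j + u' j)"
  unfolding second_difference_def by (smt (verit))

lemma second_difference_funpow_transfer:
  "second_difference x y z u \<Longrightarrow>
   second_difference ((transfer ^^ d) x) ((transfer ^^ d) y) ((transfer ^^ d) z) ((transfer ^^ d) u)"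
  by (induction d) (auto intro: second_difference_transfer)

definition second_difference_pair ::
  "weight \<times> weight \<Rightarrow> weight \<times> weight \<Rightarrow> weight \<times> weight \<Rightarrow> weight \<times> weight \<Rightarrow> bool" where
  "second_difference_pair X Y W U \<longleftrightarrow>
     second_difference (fst X) (fst Y) (fst W) (fst U) \<and> second_difference (snd X) (snd Y) (snd W) (snd U)"

lemma second_difference_pair_fst:
  "second_difference_pair X Y W U \<Longrightarrow> fst X j - 2 * fst Y j + fst W j + 4 * fst U j = 0"
  by (simp add: second_difference_pair_def second_difference_def)

lemma fst_chain_step: "fst (chain_step X) = (\<lambda>j. transfer (fst X) j + snd X j)" and snd_chain_step: "snd (chain_step X) = chain_transfer (snd X)"
  by (cases X, simp)+

lemma second_difference_chain_step:
  "second_difference_pair X Y W U \<Longrightarrow> second_difference_pair (chain_step X) (chain_step Y) (chain_step W) (chain_step U)"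
  by (simp add: second_difference_pair_def fst_chain_step snd_chain_step second_difference_add
      second_difference_transfer second_difference_chain_transfer)

lemma second_difference_funpow_chain_step:
  "second_difference_pair X Y W U \<Longrightarrow>
   second_difference_pair ((chain_step ^^ d) X) ((chain_step ^^ d) Y) ((chain_step ^^ d) W) ((chain_step ^^ d) U)"
  by (induction d) (auto intro: second_difference_chain_step)

lemma second_difference_chain_start:
  "second_difference x y z u \<Longrightarrow>
   second_difference_pair (chain_start x) (chain_start y) (chain_start z) (chain_start u)"
  unfolding second_difference_pair_def second_difference_def chain_start_def
  by (auto simp: algebra_simps) (smt (verit))

text \<open>Let E be the shift with (E g) j = g (j + 1) and T = \<open>transfer\<close>. Then E T -
  T E = E E + 1 and \<open>chain_transfer\<close> is T + 2 E, from which both components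
  follow.\<close>

lemma chain_transfer_commutator:
  "second_difference_pair (chain_step (chain_step (chain_start g))) (chain_step (chain_start (transfer g))) (chain_start (transfer (transfer g))) (chain_start g)"
proof -
  have "fst (chain_step (chain_step (chain_start g))) j - 2 * fst (chain_step (chain_start (transfer g))) j + fst (chain_start (transfer (transfer g))) j + 4 * fst (chain_start g) j = 0" for j
    \<comment> \<open>Splitting off the arguments 0 and 1 resolves the truncated
      subtractions.\<close>
    by (cases j; cases "j - 1") (simp_all add: chain_start_def transfer_def chain_transfer_def algebra_simps)
  moreover have "snd (chain_step (chain_step (chain_start g))) j - 2 * snd (chain_step (chain_start (transfer g))) j + snd (chain_start (transfer (transfer g))) j + 4 * snd (chain_start g) j = 0" for j
    by (cases j; cases "j - 1") (simp_all add: chain_start_def transfer_def chain_transfer_def algebra_simps)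
  ultimately show ?thesis by (simp add: second_difference_pair_def second_difference_def)
qed

text \<open>Write T = A + B with (A g) j = (j + 1) g (j + 1) and (B g) j = j g (j - 1), and M =
  \<open>mark\<close>. Then [A,M] = 2 A, [B,M] = - 2 B and [A,B] = M, so that [T,[T,M]] = - 4
  M.\<close>

lemma transfer_mark_commutator:
  "second_difference (transfer (transfer (mark w))) (transfer (mark (transfer w))) (mark (transfer (transfer w))) (mark w)"
proof -
  have "transfer (transfer (mark w)) j - 2 * transfer (mark (transfer w)) j + mark (transfer (transfer w)) j + 4 * mark w j = 0" for j
    by (cases j; cases "j - 1") (simp_all add: transfer_def mark_def algebra_simps)
  then show ?thesis by (simp add: second_difference_def)
qed

theorem theorem1p1:
  fixes n :: nat
  assumes "n \<ge> 2"
  shows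
    "(\<forall>m k. 2 \<le> m \<and> m + 3 \<le> k \<and> k \<le> 2 * n - 1 \<longrightarrow>
        (Delta_m ^^ 2) (secant_count (2 * n)) m k
          + 4 * secant_count (2 * n - 2) m (k - 2) = 0) \<and>
     (\<forall>m k. 2 \<le> m \<and> m + 1 \<le> k \<and> k \<le> 2 * n - 3 \<longrightarrow>
        (Delta_k ^^ 2) (secant_count (2 * n)) m k
          + 4 * secant_count (2 * n - 2) m k = 0)"
proof (intro conjI allI impI)
  fix m k assume mk: "2 \<le> m \<and> m + 3 \<le> k \<and> k \<le> 2 * n - 1"
  obtain a where a: "m = a + 2" using mk le_Suc_ex by (metis add.commute)
  \<comment> \<open>The number of \<open>transfer\<close> steps between \<open>eoc\<close> and
    \<open>pom\<close> is \<open>b\<close>, \<open>b + 1\<close>, \<open>b + 2\<close> for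
    \<open>m + 2\<close>, \<open>m + 1\<close>, \<open>m\<close>, and again \<open>b\<close> for the
    smaller trees, so one weight \<open>g\<close> serves all four terms.\<close>
  obtain b where b: "k = m + b + 3" using mk le_Suc_ex by (metis add.assoc add.commute)
  define c where "c = 2 * n - 1 - k"
  define g where "g = (transfer ^^ b) (mark ((transfer ^^ c) delta))"
  have c: "2 * n - 1 - k = c" "2 * n - 2 - 1 - (k - 2) = c" using mk by (auto simp: c_def)
  have "secant_count (2 * n) (m + 2) k = fst ((chain_step ^^ a) (chain_step (chain_step (chain_start g)))) 0"
    using secant_count_formula[of "2 * n" "m + 2" k] mk unfolding c by (simp add: a b g_def funpow_swap1)
  moreover have "secant_count (2 * n) (m + 1) k = fst ((chain_step ^^ a) (chain_step (chain_start (transfer g)))) 0"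
    using secant_count_formula[of "2 * n" "m + 1" k] mk unfolding c by (simp add: a b g_def funpow_swap1)
  moreover have "secant_count (2 * n) m k = fst ((chain_step ^^ a) (chain_start (transfer (transfer g)))) 0"
    using secant_count_formula[of "2 * n" m k] mk unfolding c by (simp add: a b g_def)
  moreover have "secant_count (2 * n - 2) m (k - 2) = fst ((chain_step ^^ a) (chain_start g)) 0"
    using secant_count_formula[of "2 * n - 2" m "k - 2"] mk unfolding c by (simp add: a b g_def)
  ultimately show "(Delta_m ^^ 2) (secant_count (2 * n)) m k + 4 * secant_count (2 * n - 2) m (k - 2) = 0"
    using second_difference_pair_fst[OF second_difference_funpow_chain_step[OF chain_transfer_commutator, of a g], of 0]
    by (simp add: numeral_2_eq_2 Delta_m_def)
next
  fix m k assume mk: "2 \<le> m \<and> m + 1 \<le> k \<and> k \<le> 2 * n - 3"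
  obtain b where b: "k = m + b + 1" using mk le_Suc_ex by (metis add.assoc add.commute)
  have k: "k + 2 < 2 * n" "k < 2 * n - 2" using mk by auto
  define c where "c = 2 * n - 3 - k"
  define w where "w = (transfer ^^ c) delta"
  \<comment> \<open>What is applied after these weights is linear and common to all four terms, so
    the relation need only be checked on the weights.\<close>
  define F where "F = (\<lambda>g. fst ((chain_step ^^ (m - 2)) (chain_start ((transfer ^^ b) g))) 0)"
  have c: "2 * n - 1 - (k + 2) = c" "2 * n - 1 - (k + 1) = Suc c" "2 * n - 1 - k = Suc (Suc c)"
    "2 * n - 2 - 1 - k = c" using mk by (auto simp: c_def)
  have "secant_count (2 * n) m (k + 2) = F (transfer (transfer (mark w)))"
    using secant_count_formula[of "2 * n" m "k + 2"] mk k unfolding c by (simp add: b F_def w_def funpow_swap1)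
  moreover have "secant_count (2 * n) m (k + 1) = F (transfer (mark (transfer w)))"
    using secant_count_formula[of "2 * n" m "k + 1"] mk k unfolding c by (simp add: b F_def w_def funpow_swap1)
  moreover have "secant_count (2 * n) m k = F (mark (transfer (transfer w)))"
    using secant_count_formula[of "2 * n" m k] mk k unfolding c by (simp add: b F_def w_def)
  moreover have "secant_count (2 * n - 2) m k = F (mark w)"
    using secant_count_formula[of "2 * n - 2" m k] mk k unfolding c by (simp add: b F_def w_def)
  moreover have "F (transfer (transfer (mark w))) - 2 * F (transfer (mark (transfer w))) + F (mark (transfer (transfer w))) + 4 * F (mark w) = 0"
    unfolding F_def
    by (intro second_difference_pair_fst second_difference_funpow_chain_step second_difference_chain_start
        second_difference_funpow_transfer transfer_mark_commutator)
  ultimately show "(Delta_k ^^ 2) (secant_count (2 * n)) m k + 4 * secant_count (2 * n - 2) m k = 0"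
    by (simp add: numeral_2_eq_2 Delta_k_def)
qed

end
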